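(* Generic finite strategic-form games have only pure-strategy strong Nash equilibria (if any). That is, for every $n\ge 2$ and all finite action sets $A_1,\ldots,A_n$, the set of utility profiles $(U_1,\ldots,U_n)\in\bigl(\mathbb{R}^{A_1\times\cdots\times A_n}\bigr)^n$ for which the game has a strong Nash equilibrium that is not a pure-strategy profile has Lebesgue measure zero.
   Context: A strategic-form game has agents $N=\{1,\ldots,n\}$, finite action sets $A_1,\ldots,A_n$ and utility functions $U_i:A_1\times\cdots\times A_n\to\mathbb{R}$. A mixed strategy of agent $i$ is a probability distribution on $A_i$; agents randomize independently and utilities extend by expectation. A strong Nash equilibrium (SNE) is a mixed profile $\mathbf{x}$ such that for no nonempty coalition $C\subseteq N$ are there mixed strategies for the members of $C$ such that, when they play these and the agents outside $C$ keep their strategies in $\mathbf{x}$, every member of $C$ obtains a strictly larger expected utility than in $\mathbf{x}$. A profile is pure if every agent plays a single action with probability one. *)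

theory Defs
  imports "HOL-Probability.Probability"
begin

text \<open>
  The agents are \<open>{1..n}\<close>. The action sets \<open>A 1, \<dots>, A n\<close> are arbitrary subsets of one
  common type \<open>'a\<close> (any finite family of finite sets can be relabelled to live in one type).
\<close>

abbreviation agents :: "nat \<Rightarrow> nat set" where
  "agents n \<equiv> {1..n}"

abbreviation action_profiles :: "nat \<Rightarrow> (nat \<Rightarrow> 'a set) \<Rightarrow> (nat \<Rightarrow> 'a) set" where
  "action_profiles n A \<equiv> PiE (agents n) A"

text \<open>
  A utility profile \<open>(U\<^sub>1, \<dots>, U\<^sub>n)\<close> is stored as one real vector whose coordinates are indexed
  by pairs (agent, action profile): \<open>U (i, a)\<close> is \<open>U\<^sub>i(a)\<close>.
\<close>

type_synonym 'a utilities = "nat \<times> (nat \<Rightarrow> 'a) \<Rightarrow> real"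

text \<open>Lebesgue measure is the completion of the finite product of the Borel measures.\<close>

definition lebesgue_games :: "nat \<Rightarrow> (nat \<Rightarrow> 'a set) \<Rightarrow> 'a utilities measure" where
  "lebesgue_games n A =
     completion (Pi\<^sub>M (agents n \<times> action_profiles n A) (\<lambda>_. lborel :: real measure))"

text \<open>Mixed profiles matter only on \<open>agents n\<close>; their values elsewhere are never used.\<close>

definition mixed_profile :: "nat \<Rightarrow> (nat \<Rightarrow> 'a set) \<Rightarrow> (nat \<Rightarrow> 'a pmf) \<Rightarrow> bool" where
  "mixed_profile n A x \<longleftrightarrow> (\<forall>i\<in>agents n. set_pmf (x i) \<subseteq> A i)"

definition pure_profile :: "nat \<Rightarrow> (nat \<Rightarrow> 'a set) \<Rightarrow> (nat \<Rightarrow> 'a pmf) \<Rightarrow> bool" where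
  "pure_profile n A x \<longleftrightarrow> (\<forall>i\<in>agents n. \<exists>a\<in>A i. x i = return_pmf a)"

text \<open>
  Independent randomization: \<open>Pi_pmf\<close> is the product distribution. The default value
  \<open>undefined\<close> outside \<open>agents n\<close> makes its outcomes elements of \<open>action_profiles n A\<close>.
\<close>

definition expected_utility :: "nat \<Rightarrow> 'a utilities \<Rightarrow> (nat \<Rightarrow> 'a pmf) \<Rightarrow> nat \<Rightarrow> real" where
  "expected_utility n U x i =
     measure_pmf.expectation (Pi_pmf (agents n) undefined x) (\<lambda>a. U (i, a))"

text \<open>\<open>override_on x y C\<close> is the profile in which \<open>C\<close> plays according to \<open>y\<close> and the rest to \<open>x\<close>.\<close>

definition strong_Nash_equilibrium ::
  "nat \<Rightarrow> (nat \<Rightarrow> 'a set) \<Rightarrow> 'a utilities \<Rightarrow> (nat \<Rightarrow> 'a pmf) \<Rightarrow> bool" where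
  "strong_Nash_equilibrium n A U x \<longleftrightarrow>
     mixed_profile n A x \<and>
     \<not> (\<exists>C y. C \<noteq> {} \<and> C \<subseteq> agents n \<and> (\<forall>i\<in>C. set_pmf (y i) \<subseteq> A i) \<and>
          (\<forall>i\<in>C. expected_utility n U (override_on x y C) i > expected_utility n U x i))"

lemma expected_utility_eq_sum:
  assumes "\<And>i. i \<in> agents n \<Longrightarrow> finite (A i)" and "mixed_profile n A x"
  shows "expected_utility n U x i =
    (\<Sum>a\<in>action_profiles n A. U (i, a) * (\<Prod>j\<in>agents n. pmf (x j) (a j)))"
proof -
  have fin: "finite (action_profiles n A)"
    using assms(1) by (intro finite_PiE) auto
  have sub: "a \<in> action_profiles n A" if "a \<in> set_pmf (Pi_pmf (agents n) undefined x)" for a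
  proof -
    have "a \<in> PiE_dflt (agents n) undefined (\<lambda>j. set_pmf (x j))"
      using that by (simp add: set_Pi_pmf comp_def)
    then show ?thesis
      using assms(2) unfolding mixed_profile_def PiE_dflt_def
      by (auto simp: PiE_iff extensional_def subset_iff)
  qed
  have "expected_utility n U x i =
      (\<Sum>a\<in>action_profiles n A. U (i, a) * pmf (Pi_pmf (agents n) undefined x) a)"
    unfolding expected_utility_def by (rule integral_measure_pmf_real[OF fin], erule sub)
  also have "\<dots> = (\<Sum>a\<in>action_profiles n A. U (i, a) * (\<Prod>j\<in>agents n. pmf (x j) (a j)))"
    by (intro sum.cong refl arg_cong2[where f = "(*)"] pmf_Pi') (auto simp: PiE_iff extensional_def)
  finally show ?thesis .
qed

end

(*
  Let x be a strong Nash equilibrium and let S k be the support of agent k. By the Nash property agent k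
  is indifferent between the actions in S k, which amounts to p = sum_k (|S k| - 1) equations, as many as
  there are free parameters of x. If two agents i and j mix, there is one equation more: were there an
  action of i that strictly benefits j and an action of j that strictly benefits i, then both could shift a
  little probability to these actions; to first order each is indifferent to its own shift and gains from
  that of the other, so the coalition {i, j} would improve. Hence (up to swapping i and j) j is indifferent
  between the actions in S i. For fixed x the p + 1 equations are linear in U and independent, so cutting
  the parameter domain into m^p cubes of side 1/m covers the bounded games in question by sets of total
  measure m^p * O(m^-(p + 1)), which tends to 0. If only one agent mixes, two of its utilities coincide.
*)
theory Submission
  imports Defs
begin

section \<open>Overdetermined families of linear equations\<close>

text \<open>
  The list \<open>es\<close> is in echelon form: the coordinate \<open>d e\<close> occurs in \<open>e\<close> but in no later equation,
  so it can be integrated out first.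
\<close>

lemma emeasure_slabs_le:
  fixes c :: "'e \<Rightarrow> 'i \<Rightarrow> real"
  assumes "finite I" "1 \<le> r" "0 < \<eta>" "0 \<le> \<delta>"
    and "sorted_wrt (\<lambda>e e'. c e' (d e) = 0) es"
    and "\<And>e. e \<in> set es \<Longrightarrow> d e \<in> I" "\<And>e. e \<in> set es \<Longrightarrow> \<eta> \<le> \<bar>c e (d e)\<bar>"
  shows "emeasure (Pi\<^sub>M I (\<lambda>_. lborel))
      {U \<in> space (Pi\<^sub>M I (\<lambda>_. lborel)). (\<forall>i\<in>I. \<bar>U i\<bar> \<le> r) \<and> (\<forall>e\<in>set es. \<bar>\<Sum>i\<in>I. c e i * U i\<bar> \<le> \<delta>)}
    \<le> ennreal ((2 * r) ^ card I * (2 * \<delta> / \<eta>) ^ length es)"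
  using assms
proof (induction es arbitrary: I)
  case Nil
  interpret lborel_product: product_sigma_finite "\<lambda>_. lborel :: real measure"
    by standard
  have abs_iff: "\<bar>y\<bar> \<le> r \<longleftrightarrow> y \<in> {-r..r}" for y
    by auto
  have "{U \<in> space (Pi\<^sub>M I (\<lambda>_. lborel)). \<forall>i\<in>I. \<bar>U i\<bar> \<le> r} = (\<Pi>\<^sub>E i\<in>I. {-r..r})"
    unfolding abs_iff by (auto simp: space_PiM PiE_iff) (simp add: extensional_def)
  then show ?case
    using Nil by (simp add: lborel_product.emeasure_PiM ennreal_power)
next
  case (Cons e es)
  interpret lborel_product: product_sigma_finite "\<lambda>_. lborel :: real measure"
    by standard
  define i where "i = d e"
  define J where "J = I - {i}"
  have J: "finite J" "i \<notin> J" "I = insert i J" "card I = Suc (card J)"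
    using Cons.prems(1,6) card.remove[of I i] unfolding J_def i_def by auto
  have zero: "c e' i = 0" if "e' \<in> set es" for e'
    using Cons.prems(5) that by (auto simp: i_def)
  have piv: "\<eta> \<le> \<bar>c e i\<bar>"
    using Cons.prems(7)[of e] by (simp add: i_def)
  \<comment> \<open>Later equations have coefficient 0 at \<open>i\<close> but one of size at least
    \<open>\<eta>\<close> > 0 at their own pivots, so these pivots survive the removal of
    \<open>i\<close>.\<close>
  have dJ: "d e' \<in> J" if "e' \<in> set es" for e'
    using Cons.prems(3) Cons.prems(6,7)[of e'] zero[OF that] that by (auto simp: J_def)
  define V where "V = {U \<in> space (Pi\<^sub>M I (\<lambda>_. lborel)). (\<forall>i\<in>I. \<bar>U i\<bar> \<le> r) \<and>
    (\<forall>e'\<in>set (e # es). \<bar>\<Sum>i\<in>I. c e' i * U i\<bar> \<le> \<delta>)}"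
  define V' where "V' = {U \<in> space (Pi\<^sub>M J (\<lambda>_. lborel)). (\<forall>i\<in>J. \<bar>U i\<bar> \<le> r) \<and>
    (\<forall>e'\<in>set es. \<bar>\<Sum>i\<in>J. c e' i * U i\<bar> \<le> \<delta>)}"
  define B where "B = 2 * \<delta> / \<eta>"
  have B0: "0 \<le> B" using Cons.prems by (simp add: B_def)
  have mV: "V \<in> sets (Pi\<^sub>M I (\<lambda>_. lborel))"
    unfolding V_def using Cons.prems(1) by measurable
  have mV': "V' \<in> sets (Pi\<^sub>M J (\<lambda>_. lborel))"
    unfolding V'_def using J(1) by measurable
  have IH: "emeasure (Pi\<^sub>M J (\<lambda>_. lborel)) V' \<le> ennreal ((2 * r) ^ card J * B ^ length es)"
    unfolding V'_def B_def using Cons.prems J dJ by (intro Cons.IH) auto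
  \<comment> \<open>With the coordinates in \<open>J\<close> fixed, equation \<open>e\<close>
    confines \<open>y\<close> to an interval of length \<open>B\<close> around its solution
    \<open>m\<close>. The later equations do not involve \<open>y\<close>, so if they or the bounds
    fail on \<open>J\<close>, no \<open>y\<close> is admissible.\<close>
  have slab: "(\<integral>\<^sup>+y. indicator V (U(i := y)) \<partial>lborel) \<le> ennreal B * indicator V' U"
    if U: "U \<in> space (Pi\<^sub>M J (\<lambda>_. lborel))" for U
  proof (cases "U \<in> V'")
    case True
    define m where "m = - (\<Sum>k\<in>J. c e k * U k) / c e i"
    have "y \<in> {m - \<delta> / \<eta> .. m + \<delta> / \<eta>}" if "U(i := y) \<in> V" for y
    proof -
      have "\<bar>\<Sum>k\<in>I. c e k * (U(i := y)) k\<bar> \<le> \<delta>"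
        using that unfolding V_def by auto
      also have "(\<Sum>k\<in>I. c e k * (U(i := y)) k) = c e i * y + (\<Sum>k\<in>J. c e k * U k)"
        using J by (auto intro!: sum.cong)
      also have "\<dots> = c e i * (y - m)"
        using piv Cons.prems(3) by (auto simp: m_def field_simps)
      finally have "\<bar>c e i\<bar> * \<bar>y - m\<bar> \<le> \<delta>" by (simp add: abs_mult)
      then have "\<eta> * \<bar>y - m\<bar> \<le> \<delta>"
        using mult_right_mono[OF piv, of "\<bar>y - m\<bar>"] by simp
      then have "\<bar>y - m\<bar> \<le> \<delta> / \<eta>"
        using Cons.prems(3) by (simp add: field_simps)
      then show ?thesis by (auto simp: abs_le_iff)
    qed
    then have "(\<integral>\<^sup>+y. indicator V (U(i := y)) \<partial>lborel) \<le> (\<integral>\<^sup>+y. indicator {m - \<delta> / \<eta> .. m + \<delta> / \<eta>} y \<partial>lborel)"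
      by (intro nn_integral_mono) (auto simp: indicator_def)
    also have "\<dots> = ennreal B"
      using Cons.prems(3,4) by (simp add: B_def)
    finally show ?thesis using True by simp
  next
    case False
    have "U(i := y) \<notin> V" for y
    proof
      assume *: "U(i := y) \<in> V"
      have "\<bar>U k\<bar> \<le> r" if "k \<in> J" for k
        using * that J unfolding V_def by (auto split: if_splits)
      moreover have "\<bar>\<Sum>k\<in>J. c e' k * U k\<bar> \<le> \<delta>" if "e' \<in> set es" for e'
      proof -
        have "(\<Sum>k\<in>I. c e' k * (U(i := y)) k) = (\<Sum>k\<in>J. c e' k * U k)"
          using J zero[OF that] by (auto intro!: sum.cong)
        then show ?thesis using * that unfolding V_def by auto
      qed
      ultimately show False using False U by (auto simp: V'_def)
    qed
    then show ?thesis by simp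
  qed
  have "emeasure (Pi\<^sub>M I (\<lambda>_. lborel)) V = (\<integral>\<^sup>+U. indicator V U \<partial>Pi\<^sub>M (insert i J) (\<lambda>_. lborel))"
    using mV J by simp
  also have "\<dots> = (\<integral>\<^sup>+U. (\<integral>\<^sup>+y. indicator V (U(i := y)) \<partial>lborel) \<partial>Pi\<^sub>M J (\<lambda>_. lborel))"
    using mV J by (intro lborel_product.product_nn_integral_insert) auto
  also have "\<dots> \<le> (\<integral>\<^sup>+U. ennreal B * indicator V' U \<partial>Pi\<^sub>M J (\<lambda>_. lborel))"
    using slab by (intro nn_integral_mono)
  also have "\<dots> = ennreal B * emeasure (Pi\<^sub>M J (\<lambda>_. lborel)) V'"
    using mV' by (simp add: nn_integral_cmult)
  also have "\<dots> \<le> ennreal B * ennreal ((2 * r) ^ card J * B ^ length es)"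
    using IH by (intro mult_left_mono) auto
  also have "\<dots> = ennreal ((2 * r) ^ card J * B ^ Suc (length es))"
    using B0 Cons.prems(2) by (simp add: ennreal_mult[symmetric] mult_ac)
  \<comment> \<open>A pivot contributes \<open>B\<close> in place of \<open>2 * r\<close>. As
    \<open>2 * r\<close> is at least 1, a further factor \<open>2 * r\<close> only weakens the bound
    and brings the exponent to \<open>card I\<close>.\<close>
  also have "\<dots> \<le> ennreal ((2 * r) ^ card I * B ^ Suc (length es))"
    using B0 Cons.prems(2) J(4) by (intro ennreal_leI mult_right_mono power_increasing) auto
  finally show ?case by (simp add: V_def B_def)
qed

text \<open>
  \<open>q x\<close> lists the parameters of \<open>x\<close>; there is one equation more than there are parameters.
\<close>

lemma overdetermined_null:
  fixes q :: "'x \<Rightarrow> 'p \<Rightarrow> real" and c :: "'x \<Rightarrow> 'e \<Rightarrow> 'i \<Rightarrow> real"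
  assumes fin: "finite I" "finite P" and len: "length es = Suc (card P)"
    and pos: "0 < \<eta>" "0 \<le> K"
    and q: "\<And>x p. x \<in> X \<Longrightarrow> p \<in> P \<Longrightarrow> 0 \<le> q x p \<and> q x p \<le> 1"
    and lip: "\<And>x y h e i. \<lbrakk>x \<in> X; y \<in> X; 0 \<le> h; \<And>p. p \<in> P \<Longrightarrow> \<bar>q x p - q y p\<bar> \<le> h; e \<in> set es; i \<in> I\<rbrakk>
        \<Longrightarrow> \<bar>c x e i - c y e i\<bar> \<le> K * h"
    and tri: "\<And>x. x \<in> X \<Longrightarrow> sorted_wrt (\<lambda>e e'. c x e' (d e) = 0) es"
    and d: "\<And>e. e \<in> set es \<Longrightarrow> d e \<in> I"
    and piv: "\<And>x e. x \<in> X \<Longrightarrow> e \<in> set es \<Longrightarrow> \<eta> \<le> \<bar>c x e (d e)\<bar>"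
  shows "{U \<in> space (Pi\<^sub>M I (\<lambda>_. lborel)). \<exists>x\<in>X. \<forall>e\<in>set es. (\<Sum>i\<in>I. c x e i * U i) = 0}
    \<in> null_sets (completion (Pi\<^sub>M I (\<lambda>_. lborel)))"
proof -
  define M where "M = Pi\<^sub>M I (\<lambda>_. lborel :: real measure)"
  \<comment> \<open>Slabs have finite measure only inside a bounded cube, so the games are exhausted
    by cubes; \<open>Suc r\<close> keeps the bound at least 1, as \<open>emeasure_slabs_le\<close>
    demands.\<close>
  define Z where "Z r = {U \<in> space M. (\<forall>i\<in>I. \<bar>U i\<bar> \<le> real (Suc r)) \<and>
      (\<exists>x\<in>X. \<forall>e\<in>set es. (\<Sum>i\<in>I. c x e i * U i) = 0)}" for r :: nat
  have "Z r \<in> null_sets (completion M)" for r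
  proof -
    define R where "R = real (Suc r)"
    define V where "V x \<delta> = {U \<in> space M. (\<forall>i\<in>I. \<bar>U i\<bar> \<le> R) \<and> (\<forall>e\<in>set es. \<bar>\<Sum>i\<in>I. c x e i * U i\<bar> \<le> \<delta>)}"
      for x \<delta>
    \<comment> \<open>\<open>cell k x\<close> indexes the cube of side \<open>1 / Suc k\<close> that
      contains the parameters of \<open>x\<close>. Representatives are taken from \<open>X\<close>
      and not at cube centres, because the pivots are bounded below only on
      \<open>X\<close>.\<close>
    define cell where "cell k x = (\<lambda>p\<in>P. nat \<lfloor>real (Suc k) * q x p\<rfloor>)" for k x
    define rep where "rep k = inv_into X (cell k)" for k
    \<comment> \<open>If \<open>x\<close> satisfies an equation exactly, the representative of its
      cell satisfies it up to \<open>L / Suc k\<close>: there are \<open>card I\<close> summands,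
      coefficients move by at most \<open>K / Suc k\<close>, and \<open>U\<close> is bounded by
      \<open>R\<close>.\<close>
    define L where "L = real (card I) * K * R"
    have L0: "0 \<le> L" using pos by (simp add: L_def R_def)
    define T where "T k = (\<Union>g\<in>cell k ` X. V (rep k g) (L / real (Suc k)))" for k
    \<comment> \<open>The factor \<open>2 ^ card P\<close> pays for the boundary: a parameter equal
      to 1 has floor \<open>Suc k\<close>, so each parameter takes up to \<open>k + 2\<close>
      values, which is at most \<open>2 * Suc k\<close>.\<close>
    define D where "D = (2 * R) ^ card I * (2 * L / \<eta>) ^ Suc (card P) * 2 ^ card P"
    have D0: "0 \<le> D" using L0 pos by (simp add: D_def R_def)
    have rep: "rep k g \<in> X" "cell k (rep k g) = g" if "g \<in> cell k ` X" for k g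
      using that unfolding rep_def by (auto intro: inv_into_into f_inv_into_f)
    have cells: "cell k ` X \<subseteq> (\<Pi>\<^sub>E p\<in>P. {..Suc k})" for k
    proof (rule image_subsetI)
      fix x assume x: "x \<in> X"
      have "nat \<lfloor>real (Suc k) * q x p\<rfloor> \<le> Suc k" if "p \<in> P" for p
      proof -
        have "real (Suc k) * q x p \<le> real (Suc k) * 1"
          using q[OF x that] by (intro mult_left_mono) auto
        then show ?thesis by (simp only: mult_1_right) linarith
      qed
      then show "cell k x \<in> (\<Pi>\<^sub>E p\<in>P. {..Suc k})" by (auto simp: cell_def)
    qed
    have fcells: "finite (cell k ` X)" for k
      using finite_subset[OF cells] fin(2) by (simp add: finite_PiE)
    have ccells: "card (cell k ` X) \<le> (k + 2) ^ card P" for k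
      using card_mono[OF _ cells, of k] fin(2) by (simp add: finite_PiE card_PiE)
    have mV: "V x \<delta> \<in> sets M" for x \<delta>
      unfolding V_def M_def using fin(1) by measurable
    have mT: "T k \<in> sets M" for k
      unfolding T_def using fcells mV by (intro sets.finite_UN) auto
    have eT: "emeasure M (T k) \<le> ennreal (D / real (Suc k))" for k
    proof -
      have "emeasure M (T k) \<le> (\<Sum>g\<in>cell k ` X. emeasure M (V (rep k g) (L / real (Suc k))))"
        unfolding T_def using fcells mV by (intro emeasure_subadditive_finite) auto
      also have "\<dots> \<le> (\<Sum>g\<in>cell k ` X. ennreal ((2 * R) ^ card I * (2 * (L / real (Suc k)) / \<eta>) ^ length es))"
      proof (intro sum_mono)
        fix g assume g: "g \<in> cell k ` X"
        show "emeasure M (V (rep k g) (L / real (Suc k)))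
          \<le> ennreal ((2 * R) ^ card I * (2 * (L / real (Suc k)) / \<eta>) ^ length es)"
          unfolding M_def V_def using fin(1) pos L0 tri[OF rep(1)[OF g]] d piv[OF rep(1)[OF g]]
          by (intro emeasure_slabs_le) (auto simp: R_def)
      qed
      also have "\<dots> = ennreal (real (card (cell k ` X)) * ((2 * R) ^ card I * (2 * (L / real (Suc k)) / \<eta>) ^ length es))"
        using L0 pos by (simp add: ennreal_mult ennreal_of_nat_eq_real_of_nat R_def)
      also have "\<dots> \<le> ennreal ((2 * real (Suc k)) ^ card P * ((2 * R) ^ card I * (2 * (L / real (Suc k)) / \<eta>) ^ length es))"
      proof (intro ennreal_leI mult_right_mono)
        have "real (card (cell k ` X)) \<le> real ((k + 2) ^ card P)"
          using ccells of_nat_mono by blast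
        also have "\<dots> \<le> (2 * real (Suc k)) ^ card P"
          unfolding of_nat_power by (intro power_mono) auto
        finally show "real (card (cell k ` X)) \<le> (2 * real (Suc k)) ^ card P" .
      qed (use L0 pos in \<open>auto simp: R_def\<close>)
      \<comment> \<open>This is where the surplus equation counts: \<open>card P + 1\<close> slabs
        of width of order \<open>1 / Suc k\<close> against \<open>Suc k ^ card P\<close> cells leave
        one factor \<open>1 / Suc k\<close>.\<close>
      also have "(2 * real (Suc k)) ^ card P * ((2 * R) ^ card I * (2 * (L / real (Suc k)) / \<eta>) ^ length es) = D / real (Suc k)"
      proof -
        have "(2 * s) ^ m * (a * (B / s) ^ Suc m) = a * B ^ Suc m * 2 ^ m / s" if "s > 0" for s a B :: real and m
        proof -
          have "(2 * s) ^ m * (a * (B / s) ^ Suc m) = 2 ^ m * a * B ^ Suc m * (s ^ m / s ^ Suc m)"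
            unfolding power_mult_distrib[of 2 s] power_divide[of B s] by simp
          also have "s ^ m / s ^ Suc m = 1 / s" using that by simp
          finally show ?thesis by simp
        qed
        moreover have "2 * (L / real (Suc k)) / \<eta> = 2 * L / \<eta> / real (Suc k)" by (simp only: divide_divide_eq_left times_divide_eq_right mult.commute)
        ultimately show ?thesis by (simp only: D_def len of_nat_0_less_iff zero_less_Suc)
      qed
      finally show ?thesis .
    qed
    have sub: "Z r \<subseteq> T k" for k
    proof
      fix U assume U: "U \<in> Z r"
      then obtain x where x: "x \<in> X" "\<And>e. e \<in> set es \<Longrightarrow> (\<Sum>i\<in>I. c x e i * U i) = 0"
        by (auto simp: Z_def)
      define y where "y = rep k (cell k x)"
      have y: "y \<in> X" "cell k y = cell k x" using rep x by (auto simp: y_def)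
      have near: "\<bar>q y p - q x p\<bar> \<le> 1 / real (Suc k)" if p: "p \<in> P" for p
      proof -
        have "nat \<lfloor>real (Suc k) * q y p\<rfloor> = nat \<lfloor>real (Suc k) * q x p\<rfloor>"
          using fun_cong[OF y(2), of p] p by (simp add: cell_def)
        moreover have "0 \<le> real (Suc k) * q y p" "0 \<le> real (Suc k) * q x p"
          using q[OF y(1) p] q[OF x(1) p] by (auto intro!: mult_nonneg_nonneg)
        ultimately have "\<lfloor>real (Suc k) * q y p\<rfloor> = \<lfloor>real (Suc k) * q x p\<rfloor>"
          by (metis int_nat_eq zero_le_floor)
        then have "\<bar>real (Suc k) * q y p - real (Suc k) * q x p\<bar> \<le> 1" by linarith
        then have "real (Suc k) * \<bar>q y p - q x p\<bar> \<le> 1"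
          by (simp del: of_nat_Suc add: right_diff_distrib[symmetric] abs_mult)
        then show ?thesis by (simp del: of_nat_Suc add: field_simps)
      qed
      have "\<bar>\<Sum>i\<in>I. c y e i * U i\<bar> \<le> L / real (Suc k)" if e: "e \<in> set es" for e
      proof -
        have "(\<Sum>i\<in>I. c y e i * U i) = (\<Sum>i\<in>I. (c y e i - c x e i) * U i)"
          using x(2)[OF e] by (simp add: left_diff_distrib sum_subtractf)
        also have "\<bar>\<dots>\<bar> \<le> (\<Sum>i\<in>I. \<bar>(c y e i - c x e i) * U i\<bar>)" by (rule sum_abs)
        also have "\<dots> \<le> (\<Sum>i\<in>I. (K * (1 / real (Suc k))) * R)"
        proof (intro sum_mono)
          fix i assume i: "i \<in> I"
          have "\<bar>c y e i - c x e i\<bar> \<le> K * (1 / real (Suc k))"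
            using near by (intro lip[OF y(1) x(1) _ _ e i]) auto
          moreover have "\<bar>U i\<bar> \<le> R" using U i by (auto simp: Z_def R_def)
          ultimately show "\<bar>(c y e i - c x e i) * U i\<bar> \<le> (K * (1 / real (Suc k))) * R"
            unfolding abs_mult using pos by (intro mult_mono) auto
        qed
        also have "\<dots> = L / real (Suc k)" by (simp add: L_def)
        finally show ?thesis .
      qed
      then have "U \<in> V y (L / real (Suc k))"
        using U by (auto simp: V_def Z_def R_def)
      then show "U \<in> T k" using x(1) by (auto simp: T_def y_def)
    qed
    \<comment> \<open>The intersection of the \<open>T k\<close> is a measurable set of measure zero
      that contains \<open>Z r\<close>; the completion then makes \<open>Z r\<close> itself
      null.\<close>
    have "emeasure M (\<Inter>k. T k) \<le> ennreal (D / real (Suc k))" for k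
      using mT by (intro order.trans[OF emeasure_mono eT[of k]]) auto
    moreover have "(\<lambda>k. ennreal (D / real (Suc k))) \<longlonglongrightarrow> ennreal 0"
      by (intro tendsto_ennrealI LIMSEQ_Suc lim_const_over_n)
    ultimately have "emeasure M (\<Inter>k. T k) \<le> ennreal 0"
      by (intro LIMSEQ_le_const) auto
    then have "(\<Inter>k. T k) \<in> null_sets M" using mT by (auto intro!: null_setsI)
    then have "(\<Inter>k. T k) \<in> null_sets (completion M)" by (rule null_sets_completionI)
    moreover have "Z r \<subseteq> (\<Inter>k. T k)" using sub by blast
    ultimately show ?thesis by (rule null_sets_completion_subset[rotated])
  qed
  then have "(\<Union>r. Z r) \<in> null_sets (completion M)" by (rule null_sets_UN)
  moreover have "{U \<in> space M. \<exists>x\<in>X. \<forall>e\<in>set es. (\<Sum>i\<in>I. c x e i * U i) = 0} \<subseteq> (\<Union>r. Z r)"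
  proof safe
    fix U x assume *: "U \<in> space M" "x \<in> X" "\<forall>e\<in>set es. (\<Sum>i\<in>I. c x e i * U i) = 0"
    obtain r where r: "(\<Sum>i\<in>I. \<bar>U i\<bar>) \<le> real r" using real_arch_simple by blast
    have "\<bar>U i\<bar> \<le> real (Suc r)" if "i \<in> I" for i
      using member_le_sum[of i I "\<lambda>i. \<bar>U i\<bar>"] that fin(1) r by auto
    then show "U \<in> (\<Union>r. Z r)" using * by (auto simp: Z_def)
  qed
  ultimately show ?thesis unfolding M_def by (rule null_sets_completion_subset[rotated])
qed

section \<open>Indifference in strong Nash equilibria\<close>

abbreviation dirac :: "'a \<Rightarrow> 'a \<Rightarrow> real" where
  "dirac s \<equiv> \<lambda>t. of_bool (t = s)"

text \<open>Arbitrary real functions take the place of probability mass functions, so that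
  differences such as \<open>dirac s - dirac t\<close> can be inserted; \<open>payoff\<close> is
  linear in each agent's function.\<close>

definition weight :: "nat \<Rightarrow> (nat \<Rightarrow> 'a \<Rightarrow> real) \<Rightarrow> (nat \<Rightarrow> 'a) \<Rightarrow> real" where
  "weight n f a = (\<Prod>k\<in>agents n. f k (a k))"

definition payoff :: "nat \<Rightarrow> (nat \<Rightarrow> 'a set) \<Rightarrow> 'a utilities \<Rightarrow> (nat \<Rightarrow> 'a \<Rightarrow> real) \<Rightarrow> nat \<Rightarrow> real" where
  "payoff n A U f k = (\<Sum>a\<in>action_profiles n A. U (k, a) * weight n f a)"

lemma weight_upd:
  assumes "k \<in> agents n"
  shows "weight n (f(k := g)) a = g (a k) * (\<Prod>l\<in>agents n - {k}. f l (a l))"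
  using assms unfolding weight_def by (subst prod.remove[of _ k]) (auto intro!: prod.cong)

lemma weight_split:
  assumes "k \<in> agents n"
  shows "weight n f a = f k (a k) * (\<Prod>l\<in>agents n - {k}. f l (a l))"
  using weight_upd[OF assms, of f "f k"] by simp

lemma payoff_upd_linear:
  assumes "k \<in> agents n"
  shows "payoff n A U (f(k := \<lambda>t. \<alpha> * g t + \<beta> * h t)) j =
    \<alpha> * payoff n A U (f(k := g)) j + \<beta> * payoff n A U (f(k := h)) j"
  by (simp add: payoff_def weight_upd[OF assms] sum_distrib_left algebra_simps flip: sum.distrib)

lemma payoff_upd_diff:
  assumes "k \<in> agents n"
  shows "payoff n A U (f(k := \<lambda>t. g t - h t)) j = payoff n A U (f(k := g)) j - payoff n A U (f(k := h)) j"
  using payoff_upd_linear[OF assms, of A U f 1 g "-1" h j] by simp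

lemma payoff_eq_average:
  assumes "k \<in> agents n" "finite (A k)"
  shows "payoff n A U f j = (\<Sum>s\<in>A k. f k s * payoff n A U (f(k := dirac s)) j)"
proof -
  have "weight n f a = (\<Sum>s\<in>A k. f k s * weight n (f(k := dirac s)) a)"
    if "a \<in> action_profiles n A" for a
  proof -
    have "a k \<in> A k" using that assms by auto
    then have "(\<Sum>s\<in>A k. f k s * dirac s (a k)) = f k (a k)"
      using assms(2) by (simp add: of_bool_def if_distrib[of "(*) _"] cong: if_cong)
    then show ?thesis
      by (simp add: weight_upd[OF assms(1)] weight_split[OF assms(1), of f]
          sum_distrib_right[symmetric] mult.assoc[symmetric] del: of_bool_eq_iff)
  qed
  then have "payoff n A U f j =
      (\<Sum>a\<in>action_profiles n A. \<Sum>s\<in>A k. f k s * (U (j, a) * weight n (f(k := dirac s)) a))"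
    unfolding payoff_def by (intro sum.cong refl) (simp add: sum_distrib_left mult_ac)
  also have "\<dots> = (\<Sum>s\<in>A k. f k s * payoff n A U (f(k := dirac s)) j)"
    unfolding payoff_def sum_distrib_left by (rule sum.swap)
  finally show ?thesis .
qed

section \<open>Consequences of the equilibrium property\<close>

context
  fixes n :: nat and A :: "nat \<Rightarrow> 'a set" and U :: "'a utilities"
  assumes finA: "\<And>i. i \<in> agents n \<Longrightarrow> finite (A i)"
begin

lemma expected_utility_eq_payoff:
  assumes "mixed_profile n A x"
  shows "expected_utility n U x i = payoff n A U (\<lambda>k. pmf (x k)) i"
  using expected_utility_eq_sum[OF finA assms] by (simp add: payoff_def weight_def)

text \<open>The payoff is the average of the pure-action payoffs, with positive weights exactly on
  the support; an average of values none of which exceeds it equals each of them. Agent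
  \<open>j\<close> may differ from \<open>k\<close>, which the argument for pairs exploits.\<close>

lemma payoff_eq_if_le_on_support:
  assumes x: "mixed_profile n A x" and k: "k \<in> agents n"
    and le: "\<And>s. s \<in> set_pmf (x k) \<Longrightarrow>
      payoff n A U ((\<lambda>l. pmf (x l))(k := dirac s)) j \<le> payoff n A U (\<lambda>l. pmf (x l)) j"
    and s: "s \<in> set_pmf (x k)"
  shows "payoff n A U ((\<lambda>l. pmf (x l))(k := dirac s)) j = payoff n A U (\<lambda>l. pmf (x l)) j"
proof -
  let ?f = "\<lambda>l. pmf (x l)"
  let ?v = "\<lambda>s. payoff n A U (?f(k := dirac s)) j" and ?p = "payoff n A U ?f j"
  have sub: "set_pmf (x k) \<subseteq> A k" using x k by (auto simp: mixed_profile_def)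
  have "(\<Sum>s\<in>A k. pmf (x k) s * (?p - ?v s)) = ?p * (\<Sum>s\<in>A k. pmf (x k) s) - (\<Sum>s\<in>A k. pmf (x k) s * ?v s)"
    by (simp add: right_diff_distrib sum_subtractf sum_distrib_left) (simp add: mult.commute)
  also have "\<dots> = 0"
    using sum_pmf_eq_1[OF finA[OF k] sub] payoff_eq_average[where A = A and U = U and f = ?f and j = j, OF k finA[OF k]] by simp
  finally have "(\<Sum>s\<in>A k. pmf (x k) s * (?p - ?v s)) = 0" .
  moreover have "0 \<le> pmf (x k) s * (?p - ?v s)" for s
    using le[of s] by (cases "s \<in> set_pmf (x k)") (auto simp: set_pmf_iff)
  ultimately have "pmf (x k) s * (?p - ?v s) = 0"
    using sum_nonneg_eq_0_iff[OF finA[OF k], of "\<lambda>s. pmf (x k) s * (?p - ?v s)"] s sub by auto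
  then show ?thesis using s by (simp add: set_pmf_iff)
qed

lemma SNE_no_joint_improvement:
  assumes "strong_Nash_equilibrium n A U x" "C \<noteq> {}" "C \<subseteq> agents n"
    and "\<And>i. i \<in> C \<Longrightarrow> set_pmf (y i) \<subseteq> A i"
  shows "\<exists>i\<in>C. payoff n A U (\<lambda>k. pmf (override_on x y C k)) i \<le> payoff n A U (\<lambda>k. pmf (x k)) i"
proof -
  have x: "mixed_profile n A x"
    using assms(1) by (simp add: strong_Nash_equilibrium_def)
  have "mixed_profile n A (override_on x y C)"
    using x assms(4) by (auto simp: mixed_profile_def override_on_def)
  moreover have "\<exists>i\<in>C. expected_utility n U (override_on x y C) i \<le> expected_utility n U x i"
    using assms unfolding strong_Nash_equilibrium_def by (meson not_le)
  ultimately show ?thesis using x by (simp add: expected_utility_eq_payoff)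
qed

text \<open>The coalition \<open>{k}\<close> cannot gain by a pure action, so the averaging lemma
  applies.\<close>

lemma SNE_indifferent:
  assumes sne: "strong_Nash_equilibrium n A U x" and k: "k \<in> agents n" and s: "s \<in> set_pmf (x k)"
  shows "payoff n A U ((\<lambda>l. pmf (x l))(k := dirac s)) k = payoff n A U (\<lambda>l. pmf (x l)) k"
proof -
  have x: "mixed_profile n A x"
    using sne by (simp add: strong_Nash_equilibrium_def)
  have "payoff n A U ((\<lambda>l. pmf (x l))(k := dirac t)) k \<le> payoff n A U (\<lambda>l. pmf (x l)) k"
    if "t \<in> set_pmf (x k)" for t
  proof -
    have "t \<in> A k" using x k that by (auto simp: mixed_profile_def)
    moreover have "(\<lambda>l. pmf (override_on x (\<lambda>_. return_pmf t) {k} l)) = (\<lambda>l. pmf (x l))(k := dirac t)"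
      by (auto simp: override_on_def fun_eq_iff pmf_return)
    ultimately show ?thesis
      using SNE_no_joint_improvement[OF sne, of "{k}" "\<lambda>_. return_pmf t"] k by simp
  qed
  then show ?thesis by (rule payoff_eq_if_le_on_support[OF x k]) (use s in auto)
qed

text \<open>A biased coin realizes the shift of probability \<open>\<epsilon>\<close> towards
  \<open>s\<close> as a genuine strategy.\<close>

lemma pmf_bernoulli_mixture:
  assumes "0 \<le> \<epsilon>" "\<epsilon> \<le> 1"
  shows "pmf (bernoulli_pmf \<epsilon> \<bind> (\<lambda>b. if b then return_pmf s else p)) =
    (\<lambda>t. \<epsilon> * dirac s t + (1 - \<epsilon>) * pmf p t)"
  using assms by (auto simp: fun_eq_iff pmf_bind pmf_return)

lemma SNE_pair_indifferent:
  assumes sne: "strong_Nash_equilibrium n A U x" and ij: "i \<in> agents n" "j \<in> agents n" "i \<noteq> j"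
  shows "(\<forall>s\<in>set_pmf (x i). payoff n A U ((\<lambda>l. pmf (x l))(i := dirac s)) j = payoff n A U (\<lambda>l. pmf (x l)) j) \<or>
    (\<forall>s\<in>set_pmf (x j). payoff n A U ((\<lambda>l. pmf (x l))(j := dirac s)) i = payoff n A U (\<lambda>l. pmf (x l)) i)"
proof (rule ccontr)
  let ?f = "\<lambda>l. pmf (x l)"
  assume neg: "\<not> ?thesis"
  have x: "mixed_profile n A x"
    using sne by (simp add: strong_Nash_equilibrium_def)
  \<comment> \<open>By the averaging lemma, if no supported action of \<open>i\<close> benefited
    \<open>j\<close> strictly, \<open>j\<close> would be indifferent to all of them; likewise for
    \<open>c\<close> with the roles exchanged.\<close>
  obtain a where a: "a \<in> set_pmf (x i)" "payoff n A U ?f j < payoff n A U (?f(i := dirac a)) j"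
    using payoff_eq_if_le_on_support[OF x ij(1), of j] neg by (meson not_le)
  obtain c where c: "c \<in> set_pmf (x j)" "payoff n A U ?f i < payoff n A U (?f(j := dirac c)) i"
    using payoff_eq_if_le_on_support[OF x ij(2), of i] neg by (meson not_le)
  define P where "P l = payoff n A U ?f l" for l
  define Q where "Q l = payoff n A U (?f(i := dirac a, j := dirac c)) l" for l
  define D where "D = payoff n A U (?f(i := dirac a)) j - P j"
  define E where "E = payoff n A U (?f(j := dirac c)) i - P i"
  \<comment> \<open>The expression is the gain of \<open>j\<close> divided by
    \<open>\<epsilon>\<close> when both agents shift by \<open>\<epsilon>\<close>; it tends to the
    first-order gain \<open>D > 0\<close>. The same holds for \<open>i\<close> and \<open>E\<close>,
    so one small \<open>\<epsilon>\<close> serves both.\<close>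
  have "((\<lambda>\<epsilon>. (1 - \<epsilon>) * D + \<epsilon> * (Q j - P j)) \<longlongrightarrow> (1 - 0) * D + 0 * (Q j - P j)) (at_right 0)"
    by (intro tendsto_intros)
  then have 1: "eventually (\<lambda>\<epsilon>. 0 < (1 - \<epsilon>) * D + \<epsilon> * (Q j - P j)) (at_right 0)"
    by (rule order_tendstoD) (use a in \<open>simp add: D_def P_def\<close>)
  have "((\<lambda>\<epsilon>. (1 - \<epsilon>) * E + \<epsilon> * (Q i - P i)) \<longlongrightarrow> (1 - 0) * E + 0 * (Q i - P i)) (at_right 0)"
    by (intro tendsto_intros)
  then have 2: "eventually (\<lambda>\<epsilon>. 0 < (1 - \<epsilon>) * E + \<epsilon> * (Q i - P i)) (at_right 0)"
    by (rule order_tendstoD) (use c in \<open>simp add: E_def P_def\<close>)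
  have 3: "eventually (\<lambda>\<epsilon>::real. \<epsilon> \<in> {0<..<1}) (at_right 0)"
    by (rule eventually_at_right_real) simp
  obtain \<epsilon> where \<epsilon>: "0 < \<epsilon>" "\<epsilon> < 1" "0 < (1 - \<epsilon>) * D + \<epsilon> * (Q j - P j)"
      "0 < (1 - \<epsilon>) * E + \<epsilon> * (Q i - P i)"
    using eventually_happens[OF eventually_conj[OF 1 eventually_conj[OF 2 3]]] by auto
  define y where "y l = bernoulli_pmf \<epsilon> \<bind> (\<lambda>b. if b then return_pmf (if l = i then a else c) else x l)" for l
  have y: "set_pmf (y l) \<subseteq> A l" if "l \<in> {i, j}" for l
  proof -
    have "set_pmf (x i) \<subseteq> A i" "set_pmf (x j) \<subseteq> A j"
      using x ij by (auto simp: mixed_profile_def)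
    then show ?thesis
      using that a(1) c(1) unfolding y_def by (auto split: if_splits)
  qed
  have dev: "(\<lambda>k. pmf (override_on x y {i, j} k)) =
      ?f(i := \<lambda>t. \<epsilon> * dirac a t + (1 - \<epsilon>) * ?f i t, j := \<lambda>t. \<epsilon> * dirac c t + (1 - \<epsilon>) * ?f j t)"
    using ij(3) \<epsilon>
    by (intro ext) (auto simp: override_on_def y_def pmf_bernoulli_mixture)
  \<comment> \<open>Bilinear expansion over the four combinations: each of \<open>i\<close> and
    \<open>j\<close> either keeps its strategy or switches to \<open>a\<close> or
    \<open>c\<close>.\<close>
  have expand: "payoff n A U (\<lambda>k. pmf (override_on x y {i, j} k)) l =
      \<epsilon> * (\<epsilon> * Q l + (1 - \<epsilon>) * payoff n A U (?f(j := dirac c)) l) +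
      (1 - \<epsilon>) * (\<epsilon> * payoff n A U (?f(i := dirac a)) l + (1 - \<epsilon>) * P l)" for l
  proof -
    have *: "?f(i := g, j := h) = ?f(j := h, i := g)" for g h
      using ij(3) by (rule fun_upd_twist)
    have "payoff n A U (?f(i := g, j := ?f j)) l = payoff n A U (?f(i := g)) l"
      "payoff n A U (?f(j := h, i := ?f i)) l = payoff n A U (?f(j := h)) l" for g h
      using ij(3) by (auto intro!: arg_cong[where f = "\<lambda>f. payoff n A U f l"])
    moreover have "payoff n A U (?f(i := g)) l = \<epsilon> * payoff n A U (?f(i := dirac a)) l + (1 - \<epsilon>) * P l"
      if "g = (\<lambda>t. \<epsilon> * dirac a t + (1 - \<epsilon>) * ?f i t)" for g
      unfolding that payoff_upd_linear[OF ij(1)] by (simp add: P_def fun_upd_idem)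
    moreover have "payoff n A U (?f(j := dirac c, i := g)) l = \<epsilon> * Q l + (1 - \<epsilon>) * payoff n A U (?f(j := dirac c)) l"
      if "g = (\<lambda>t. \<epsilon> * dirac a t + (1 - \<epsilon>) * ?f i t)" for g
      unfolding that payoff_upd_linear[OF ij(1)] using calculation(2) by (simp add: Q_def *)
    ultimately show ?thesis
      unfolding dev payoff_upd_linear[OF ij(2)] by (simp add: *)
  qed
  \<comment> \<open>By the Nash property an agent's own switch alone leaves its payoff unchanged, so
    no own term of first order competes with \<open>D\<close> and \<open>E\<close>.\<close>
  have "payoff n A U (?f(i := dirac a)) i = P i" "payoff n A U (?f(j := dirac c)) j = P j"
    using SNE_indifferent[OF sne] ij a c by (auto simp: P_def)
  then have "payoff n A U (\<lambda>k. pmf (override_on x y {i, j} k)) j - P j = \<epsilon> * ((1 - \<epsilon>) * D + \<epsilon> * (Q j - P j))"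
    "payoff n A U (\<lambda>k. pmf (override_on x y {i, j} k)) i - P i = \<epsilon> * ((1 - \<epsilon>) * E + \<epsilon> * (Q i - P i))"
    unfolding expand by (simp_all add: D_def E_def algebra_simps)
  then have "payoff n A U (\<lambda>k. pmf (override_on x y {i, j} k)) j > P j"
    "payoff n A U (\<lambda>k. pmf (override_on x y {i, j} k)) i > P i"
    using \<epsilon> by (smt (verit) mult_pos_pos)+
  then show False
    using SNE_no_joint_improvement[OF sne, of "{i, j}" y] y ij unfolding P_def by auto
qed

end

section \<open>Null sets of games\<close>

lemma weight_cong:
  assumes "\<And>k. k \<in> agents n \<Longrightarrow> f k (a k) = g k (a k)"
  shows "weight n f a = weight n g a"
  using assms unfolding weight_def by (intro prod.cong) auto

lemma abs_weight_diff_le: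
  assumes "\<And>k. k \<in> agents n \<Longrightarrow> \<bar>f k (a k)\<bar> \<le> 1" "\<And>k. k \<in> agents n \<Longrightarrow> \<bar>g k (a k)\<bar> \<le> 1"
    and "\<And>k. k \<in> agents n \<Longrightarrow> \<bar>f k (a k) - g k (a k)\<bar> \<le> h"
  shows "\<bar>weight n f a - weight n g a\<bar> \<le> real n * h"
proof -
  have "\<bar>weight n f a - weight n g a\<bar> \<le> (\<Sum>k\<in>agents n. \<bar>f k (a k) - g k (a k)\<bar>)"
    unfolding weight_def using norm_prod_diff[of "agents n" "\<lambda>k. f k (a k)" "\<lambda>k. g k (a k)"] assms by simp
  also have "\<dots> \<le> (\<Sum>k\<in>agents n. h)" using assms by (intro sum_mono)
  finally show ?thesis by simp
qed

lemma abs_weight_le_1: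
  assumes "\<And>k. k \<in> agents n \<Longrightarrow> \<bar>f k (a k)\<bar> \<le> 1"
  shows "\<bar>weight n f a\<bar> \<le> 1"
  unfolding weight_def abs_prod using assms by (intro prod_le_1) auto

lemma weight_ge:
  assumes "\<And>k. k \<in> agents n \<Longrightarrow> \<epsilon> \<le> f k (a k)" "0 \<le> \<epsilon>"
  shows "\<epsilon> ^ n \<le> weight n f a"
proof -
  have "(\<Prod>k\<in>agents n. \<epsilon>) \<le> weight n f a"
    unfolding weight_def using assms by (intro prod_mono) auto
  then show ?thesis by simp
qed

text \<open>Brings an indifference equation, which involves the utilities of one agent only, into
  the form of a linear form in all coordinates of \<open>U\<close>.\<close>

lemma sum_single_agent:
  fixes U :: "'a utilities"
  assumes "finite F" "finite B" "k \<in> F"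
  shows "(\<Sum>p\<in>F \<times> B. (of_bool (fst p = k) * w (snd p)) * U p) = (\<Sum>t\<in>B. U (k, t) * w t)"
proof -
  have "(\<Sum>p\<in>F \<times> B. (of_bool (fst p = k) * w (snd p)) * U p)
      = (\<Sum>k'\<in>F. \<Sum>t\<in>B. (of_bool (k' = k) * w t) * U (k', t))"
    by (simp add: sum.cartesian_product split_def)
  also have "\<dots> = (\<Sum>k'\<in>F. if k' = k then \<Sum>t\<in>B. U (k, t) * w t else 0)"
    by (intro sum.cong) (auto simp: mult_ac)
  also have "\<dots> = (\<Sum>t\<in>B. U (k, t) * w t)" using assms by simp
  finally show ?thesis .
qed

text \<open>The instance of \<open>overdetermined_null\<close> with no parameters and the single
  equation \<open>U u - U v = 0\<close>, with pivot \<open>u\<close>.\<close>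

lemma hyperplane_null:
  fixes u v :: 'i
  assumes "finite I" "u \<in> I" "v \<in> I" "u \<noteq> v"
  shows "{U \<in> space (Pi\<^sub>M I (\<lambda>_. lborel)). (U u :: real) = U v} \<in> null_sets (completion (Pi\<^sub>M I (\<lambda>_. lborel)))"
proof -
  have "{U \<in> space (Pi\<^sub>M I (\<lambda>_. lborel)). \<exists>x\<in>{()}. \<forall>e\<in>set [()].
      (\<Sum>i\<in>I. (of_bool (i = u) - of_bool (i = v)) * U i) = (0 :: real)}
    \<in> null_sets (completion (Pi\<^sub>M I (\<lambda>_. lborel)))"
    using assms
    by (intro overdetermined_null[where P = "{}" and \<eta> = 1 and K = 0 and d = "\<lambda>_. u" and q = "\<lambda>_ _. 0"
          and c = "\<lambda>_ _ i. of_bool (i = u) - of_bool (i = v)"]) auto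
  also have "{U \<in> space (Pi\<^sub>M I (\<lambda>_. lborel)). \<exists>x\<in>{()}. \<forall>e\<in>set [()].
      (\<Sum>i\<in>I. (of_bool (i = u) - of_bool (i = v)) * U i) = (0 :: real)} =
      {U \<in> space (Pi\<^sub>M I (\<lambda>_. lborel)). (U u :: real) = U v}"
    using assms by (auto simp: left_diff_distrib sum_subtractf of_bool_def if_distrib[of "\<lambda>x. x * _"] cong: if_cong)
  finally show ?thesis .
qed

text \<open>The lower bound \<open>\<epsilon>\<close> on the supported weights keeps the pivots
  uniformly away from 0; \<open>\<epsilon>\<close> later runs through a sequence tending to
  0.\<close>

definition mixtures :: "nat \<Rightarrow> (nat \<Rightarrow> 'a set) \<Rightarrow> real \<Rightarrow> (nat \<Rightarrow> 'a \<Rightarrow> real) set" where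
  "mixtures n S \<epsilon> = {f. \<forall>k\<in>agents n. (\<forall>s\<in>S k. \<epsilon> \<le> f k s) \<and> (\<forall>s. s \<notin> S k \<longrightarrow> f k s = 0) \<and> (\<Sum>s\<in>S k. f k s) = 1}"

lemma mixtures_bounds:
  assumes "f \<in> mixtures n S \<epsilon>" "k \<in> agents n" "finite (S k)" "0 \<le> \<epsilon>"
  shows "0 \<le> f k s" "f k s \<le> 1"
proof -
  have nonneg: "0 \<le> f k t" for t
    using assms unfolding mixtures_def by (cases "t \<in> S k") force+
  then show "0 \<le> f k s" .
  show "f k s \<le> 1"
  proof (cases "s \<in> S k")
    case True
    then have "f k s \<le> (\<Sum>t\<in>S k. f k t)" using nonneg assms(3) by (intro member_le_sum) auto
    then show ?thesis using assms by (simp add: mixtures_def)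
  qed (use assms in \<open>simp add: mixtures_def\<close>)
qed

text \<open>The weight of \<open>s0\<close> is no free parameter: it is 1 minus the other weights,
  so its change is at most the sum of theirs.\<close>

lemma mixtures_close:
  assumes f: "f \<in> mixtures n S \<epsilon>" and g: "g \<in> mixtures n S \<epsilon>" and k: "k \<in> agents n"
    and fin: "finite (S k)" and s0: "s0 \<in> S k" and h: "0 \<le> h"
    and near: "\<And>s. s \<in> S k - {s0} \<Longrightarrow> \<bar>f k s - g k s\<bar> \<le> h"
  shows "\<bar>f k s - g k s\<bar> \<le> real (card (S k)) * h"
proof -
  have *: "\<bar>f k s0 - g k s0\<bar> \<le> real (card (S k)) * h"
  proof -
    have "f k s0 - g k s0 = (\<Sum>s\<in>S k - {s0}. g k s - f k s)"
      using f g k fin s0 by (simp add: mixtures_def sum_subtractf sum_diff1)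
    also have "\<bar>\<dots>\<bar> \<le> (\<Sum>s\<in>S k - {s0}. \<bar>g k s - f k s\<bar>)" by (rule sum_abs)
    also have "\<dots> \<le> (\<Sum>s\<in>S k - {s0}. h)"
      using near by (intro sum_mono) (simp add: abs_minus_commute)
    also have "\<dots> \<le> real (card (S k)) * h"
      using fin h by (simp add: mult_right_mono card_Diff1_le)
    finally show ?thesis .
  qed
  have 1: "h \<le> real (card (S k)) * h"
  proof -
    have "1 \<le> card (S k)" using fin s0 by (auto simp: Suc_le_eq card_gt_0_iff)
    then have "1 \<le> real (card (S k))" by simp
    from mult_right_mono[OF this h] show ?thesis by simp
  qed
  show ?thesis
  proof (cases "s \<in> S k")
    case True
    then show ?thesis using * near[of s] 1 by (cases "s = s0") auto
  next
    case False
    then show ?thesis using f g k h by (simp add: mixtures_def)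
  qed
qed

text \<open>The weights of the actions other than \<open>t0 k\<close> are the free parameters; the
  own indifferences give one equation for each, and the indifference of \<open>j\<close> over
  \<open>S i\<close> is the surplus one. The actions \<open>a\<close> and \<open>c\<close> certify
  that both agents mix, and \<open>t0\<close> changed at both places yields the pivot of the surplus
  equation.\<close>

lemma mixing_pair_null:
  fixes n :: nat and A S :: "nat \<Rightarrow> 'a set"
  defines "I \<equiv> agents n \<times> action_profiles n A"
  assumes finA: "\<And>k. k \<in> agents n \<Longrightarrow> finite (A k)" and SA: "\<And>k. k \<in> agents n \<Longrightarrow> S k \<subseteq> A k"
    and t0: "t0 \<in> (\<Pi>\<^sub>E k\<in>agents n. S k)"
    and ij: "i \<in> agents n" "j \<in> agents n" "i \<noteq> j"
    and a: "a \<in> S i" "a \<noteq> t0 i" and c: "c \<in> S j" "c \<noteq> t0 j"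
    and \<epsilon>: "0 < \<epsilon>" "\<epsilon> \<le> 1"
  shows "{U \<in> space (Pi\<^sub>M I (\<lambda>_. lborel)). \<exists>f\<in>mixtures n S \<epsilon>.
      (\<forall>k\<in>agents n. \<forall>s\<in>S k. payoff n A U (f(k := dirac s)) k = payoff n A U f k) \<and>
      (\<forall>s\<in>S i. payoff n A U (f(i := dirac s)) j = payoff n A U f j)}
    \<in> null_sets (completion (Pi\<^sub>M I (\<lambda>_. lborel)))"
proof -
  define P where "P = (SIGMA k:agents n. S k - {t0 k})"
  text \<open>
    \<open>Some (k, s)\<close> is the equation that \<open>k\<close> is indifferent between \<open>s\<close> and \<open>t0 k\<close>. \<open>None\<close> is
    \<open>f i (t0 i)\<close> times the equation that \<open>j\<close> is indifferent between \<open>a\<close> and \<open>t0 i\<close> of \<open>i\<close>, plus the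
    \<open>f j\<close>-weighted sum of the Nash equations of \<open>j\<close>; this combination cancels the pivots
    \<open>U (j, t0(j := s))\<close> and keeps a positive coefficient at \<open>U (j, t0(i := a, j := c))\<close>.
  \<close>
  define w where "w f e t = (case e of
      Some (k, s) \<Rightarrow> weight n (f(k := \<lambda>u. dirac s u - dirac (t0 k) u)) t
    | None \<Rightarrow> f i (t0 i) * weight n (f(i := \<lambda>u. dirac a u - dirac (t0 i) u)) t
        + weight n (f(j := \<lambda>u. f j u - dirac (t0 j) u)) t)" for f e t
  define player where "player e = (case e of Some (k, s) \<Rightarrow> k | None \<Rightarrow> j)" for e :: "(nat \<times> 'a) option"
  define C where "C f e p = of_bool (fst p = player e) * w f e (snd p)" for f e p
  define d where "d e = (case e of Some (k, s) \<Rightarrow> (k, t0(k := s)) | None \<Rightarrow> (j, t0(i := a, j := c)))" for e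
  define N where "N = (\<Sum>k\<in>agents n. card (S k))"
  have finS: "finite (S k)" if "k \<in> agents n" for k
    using finite_subset[OF SA finA] that by blast
  have t0S: "t0 k \<in> S k" if "k \<in> agents n" for k using t0 that by auto
  have finP: "finite P" using finS by (auto simp: P_def)
  have finAP: "finite (action_profiles n A)" using finA by (intro finite_PiE) auto
  have finI: "finite I" using finAP by (simp add: I_def)
  obtain ps where ps: "set ps = P" "distinct ps" using finite_distinct_list[OF finP] by blast
  \<comment> \<open>\<open>None\<close> stands last because its coefficients vanish at the pivots of
    all Nash equations, whereas its own pivot does occur in the Nash equation of \<open>j\<close>
    for \<open>c\<close>.\<close>
  define es where "es = map Some ps @ [None]"
  have len: "length es = Suc (card P)" using ps distinct_card[OF ps(2)] by (simp add: es_def)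
  have es_cases: "(\<exists>k s. e = Some (k, s) \<and> k \<in> agents n \<and> s \<in> S k \<and> s \<noteq> t0 k) \<or> e = None"
    if "e \<in> set es" for e
    using that ps(1) by (auto simp: es_def P_def)
  have bounds: "0 \<le> f k s" "f k s \<le> 1" if "f \<in> mixtures n S \<epsilon>" "k \<in> agents n" for f k s
    using mixtures_bounds[OF that finS[OF that(2)]] \<epsilon> by auto
  have lower: "\<epsilon> \<le> f k s" if "f \<in> mixtures n S \<epsilon>" "k \<in> agents n" "s \<in> S k" for f k s
    using that by (simp add: mixtures_def)
  have "{U \<in> space (Pi\<^sub>M I (\<lambda>_. lborel)). \<exists>f\<in>mixtures n S \<epsilon>. \<forall>e\<in>set es. (\<Sum>p\<in>I. C f e p * U p) = 0}
    \<in> null_sets (completion (Pi\<^sub>M I (\<lambda>_. lborel)))"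
  proof (rule overdetermined_null[where q = "\<lambda>f p. f (fst p) (snd p)" and d = d])
    show "finite I" "finite P" "length es = Suc (card P)" by fact+
    show "0 < \<epsilon> ^ n" using \<epsilon> by simp
    \<comment> \<open>All weights move by at most \<open>N * h\<close>. In the equation
      \<open>None\<close> the factor \<open>f i (t0 i)\<close> contributes \<open>N * h\<close> and
      each of the two products \<open>n * N * h\<close>.\<close>
    show "0 \<le> (2 * real n + 1) * real N" by simp
    show "0 \<le> f (fst p) (snd p) \<and> f (fst p) (snd p) \<le> 1" if "f \<in> mixtures n S \<epsilon>" "p \<in> P" for f p
      using bounds that by (auto simp: P_def)
  next
    fix f g h e p
    assume f: "f \<in> mixtures n S \<epsilon>" and g: "g \<in> mixtures n S \<epsilon>" and h: "(0::real) \<le> h"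
      and near: "\<And>p. p \<in> P \<Longrightarrow> \<bar>f (fst p) (snd p) - g (fst p) (snd p)\<bar> \<le> h"
      and e: "e \<in> set es" and p: "p \<in> I"
    have close: "\<bar>f k s - g k s\<bar> \<le> real N * h" if k: "k \<in> agents n" for k s
    proof -
      have "\<bar>f k s - g k s\<bar> \<le> real (card (S k)) * h"
        using near[of "(k, _)"] k
        by (intro mixtures_close[OF f g k finS[OF k] t0S[OF k] h]) (auto simp: P_def)
      also have "\<dots> \<le> real N * h"
        using k h unfolding N_def by (intro mult_right_mono of_nat_mono member_le_sum) auto
      finally show ?thesis .
    qed
    have Nh: "0 \<le> real N * h" using h by simp
    have lin: "\<bar>weight n (f(k := u)) t - weight n (g(k := v)) t\<bar> \<le> real n * (real N * h)"
      if "\<bar>u (t k)\<bar> \<le> 1" "\<bar>v (t k)\<bar> \<le> 1" "\<bar>u (t k) - v (t k)\<bar> \<le> real N * h" for u v t k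
      using that bounds[OF f] bounds[OF g] close by (intro abs_weight_diff_le) auto
    have "\<bar>w f e t - w g e t\<bar> \<le> (2 * real n + 1) * real N * h" for t
    proof (cases e)
      case None
      let ?W = "\<lambda>f. weight n (f(i := \<lambda>u. dirac a u - dirac (t0 i) u)) t"
      let ?V = "\<lambda>f. weight n (f(j := \<lambda>u. f j u - dirac (t0 j) u)) t"
      have "\<bar>f i (t0 i) * ?W f - g i (t0 i) * ?W g\<bar> = \<bar>(f i (t0 i) - g i (t0 i)) * ?W f + g i (t0 i) * (?W f - ?W g)\<bar>"
        by (simp add: algebra_simps)
      also have "\<dots> \<le> \<bar>f i (t0 i) - g i (t0 i)\<bar> * \<bar>?W f\<bar> + \<bar>g i (t0 i)\<bar> * \<bar>?W f - ?W g\<bar>"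
        unfolding abs_mult[symmetric] by (rule abs_triangle_ineq)
      also have "\<dots> \<le> (real N * h) * 1 + 1 * (real n * (real N * h))"
      proof (intro add_mono mult_mono)
        show "\<bar>?W f\<bar> \<le> 1" using bounds[OF f] by (intro abs_weight_le_1) auto
        show "\<bar>?W f - ?W g\<bar> \<le> real n * (real N * h)" using Nh by (intro lin) auto
      qed (use close[OF ij(1)] bounds[OF g ij(1)] Nh in auto)
      finally have 1: "\<bar>f i (t0 i) * ?W f - g i (t0 i) * ?W g\<bar> \<le> real N * h + real n * (real N * h)" by simp
      have 2: "\<bar>?V f - ?V g\<bar> \<le> real n * (real N * h)"
        using bounds[OF f ij(2), of "t j"] bounds[OF g ij(2), of "t j"] close[OF ij(2)]
        by (intro lin) (auto simp: of_bool_def)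
      have "\<bar>w f e t - w g e t\<bar> \<le> \<bar>f i (t0 i) * ?W f - g i (t0 i) * ?W g\<bar> + \<bar>?V f - ?V g\<bar>"
        unfolding None w_def by simp
      then show ?thesis using 1 2 by (simp add: algebra_simps)
    next
      case (Some ks)
      obtain k s where ks: "e = Some (k, s)" using Some by (cases ks) auto
      have "\<bar>w f e t - w g e t\<bar> \<le> real n * (real N * h)"
        unfolding ks w_def option.case prod.case using Nh by (intro lin) auto
      also have "\<dots> \<le> (2 * real n + 1) * (real N * h)" using Nh by (intro mult_right_mono) auto
      finally show ?thesis by (simp add: mult_ac)
    qed
    then show "\<bar>C f e p - C g e p\<bar> \<le> (2 * real n + 1) * real N * h"
      unfolding C_def using h by (auto simp: of_bool_def)
  next
    fix f assume f: "f \<in> mixtures n S \<epsilon>"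
    \<comment> \<open>For equal agents, the pivot profile \<open>t0(k := s)\<close> lets
      \<open>k\<close> play \<open>s\<close>, which is neither the action \<open>s'\<close> of the
      other equation nor \<open>t0 k\<close>; for different agents the equations concern disjoint
      utilities.\<close>
    have Some_zero: "C f (Some p') (d (Some p)) = 0" if "p \<in> P" "p' \<in> P" "p \<noteq> p'" for p p'
    proof -
      obtain k s k' s' where eq: "p = (k, s)" "p' = (k', s')" by (cases p, cases p')
      then have "k \<in> agents n" "s \<noteq> t0 k" using that by (auto simp: P_def)
      then show ?thesis
        using that(3) unfolding eq by (auto simp: C_def d_def w_def player_def weight_upd)
    qed
    have None_zero: "C f None (d (Some p)) = 0" if "p \<in> P" for p
    proof -
      obtain k s where eq: "p = (k, s)" by (cases p)
      then have s: "s \<noteq> t0 k" using that by (auto simp: P_def)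
      show ?thesis
      proof (cases "k = j")
        case True
        let ?t = "t0(j := s)"
        \<comment> \<open>At \<open>t0(j := s)\<close> agent \<open>i\<close> plays
          \<open>t0 i\<close>, so the difference is -1 and the prefactor \<open>f i (t0 i)\<close>
          completes the product to \<open>- weight n f ?t\<close>, which the second summand
          cancels.\<close>
        have "f i (t0 i) * weight n (f(i := \<lambda>u. dirac a u - dirac (t0 i) u)) ?t = - weight n f ?t"
          using ij a by (simp add: weight_upd weight_split[OF ij(1), of f])
        moreover have "weight n (f(j := \<lambda>u. f j u - dirac (t0 j) u)) ?t = weight n f ?t"
          using s True by (intro weight_cong) auto
        ultimately show ?thesis unfolding eq True by (simp add: C_def d_def w_def)
      next
        case False
        then show ?thesis unfolding eq by (simp add: C_def d_def player_def)
      qed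
    qed
    have "sorted_wrt (\<lambda>p p'. C f (Some p') (d (Some p)) = 0) qs"
      if "distinct qs" "set qs \<subseteq> P" for qs
      using that by (induction qs) (auto intro!: Some_zero)
    then show "sorted_wrt (\<lambda>e e'. C f e' (d e) = 0) es"
      using ps None_zero by (auto simp: es_def sorted_wrt_append sorted_wrt_map)
  next
    fix e assume e: "e \<in> set es"
    show "d e \<in> I"
      using es_cases[OF e] t0 SA ij a c
      by (fastforce simp: d_def I_def PiE_iff extensional_def)
    fix f assume f: "f \<in> mixtures n S \<epsilon>"
    from es_cases[OF e] show "\<epsilon> ^ n \<le> \<bar>C f e (d e)\<bar>"
    proof (elim disjE exE conjE)
      fix k s assume ks: "e = Some (k, s)" "k \<in> agents n" "s \<in> S k" "s \<noteq> t0 k"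
      have "\<epsilon> ^ n \<le> weight n (f(k := \<lambda>u. dirac s u - dirac (t0 k) u)) (t0(k := s))"
        using \<epsilon> ks(4) lower[OF f] t0S by (intro weight_ge) auto
      then show ?thesis by (simp add: ks(1) C_def d_def w_def player_def)
    next
      assume None: "e = None"
      let ?t = "t0(i := a, j := c)"
      \<comment> \<open>The bound 0 in \<open>weight_ge\<close> gives nonnegativity of the first
        summand; \<open>c \<noteq> t0 j\<close> turns the factor of \<open>j\<close> in the second
        into \<open>f j c\<close>, so that summand alone reaches
        \<open>\<epsilon> ^ n\<close>.\<close>
      have "0 ^ n \<le> weight n (f(i := \<lambda>u. dirac a u - dirac (t0 i) u)) ?t"
        using ij(3) a bounds[OF f] by (intro weight_ge) auto
      then have "0 \<le> f i (t0 i) * weight n (f(i := \<lambda>u. dirac a u - dirac (t0 i) u)) ?t"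
        using bounds[OF f ij(1)] ij(1) by (intro mult_nonneg_nonneg) (auto simp: power_0_left)
      moreover have "\<epsilon> ^ n \<le> weight n (f(j := \<lambda>u. f j u - dirac (t0 j) u)) ?t"
        using \<epsilon> ij a c lower[OF f] t0S by (intro weight_ge) auto
      ultimately show ?thesis by (simp add: None C_def d_def w_def player_def)
    qed
  qed
  moreover have "(\<Sum>p\<in>I. C f e p * U p) = 0"
    if "e \<in> set es"
      and nash: "\<And>k s. k \<in> agents n \<Longrightarrow> s \<in> S k \<Longrightarrow> payoff n A U (f(k := dirac s)) k = payoff n A U f k"
      and pair: "\<And>s. s \<in> S i \<Longrightarrow> payoff n A U (f(i := dirac s)) j = payoff n A U f j"
    for U f e
  proof -
    have *: "(\<Sum>p\<in>I. C f e p * U p) = (\<Sum>t\<in>action_profiles n A. U (player e, t) * w f e t)"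
      unfolding I_def C_def using es_cases[OF that(1)] ij finAP
      by (intro sum_single_agent) (auto simp: player_def)
    from es_cases[OF that(1)] show ?thesis
    proof (elim disjE exE conjE)
      fix k s assume ks: "e = Some (k, s)" "k \<in> agents n" "s \<in> S k" "s \<noteq> t0 k"
      have "(\<Sum>p\<in>I. C f e p * U p) = payoff n A U (f(k := \<lambda>u. dirac s u - dirac (t0 k) u)) k"
        unfolding * by (simp add: ks(1) w_def player_def payoff_def)
      then show ?thesis
        using nash[OF ks(2)] ks t0S by (simp add: payoff_upd_diff)
    next
      assume None: "e = None"
      \<comment> \<open>As \<open>f j\<close> sums to 1, the weighted sum of
        \<open>dirac s - dirac (t0 j)\<close> is \<open>f j - dirac (t0 j)\<close>; the second
        summand is thus the payoff difference between \<open>f j\<close> and \<open>t0 j\<close>,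
        zero by the Nash property.\<close>
      have "(\<Sum>p\<in>I. C f e p * U p) =
          f i (t0 i) * payoff n A U (f(i := \<lambda>u. dirac a u - dirac (t0 i) u)) j
          + payoff n A U (f(j := \<lambda>u. f j u - dirac (t0 j) u)) j"
        unfolding * by (simp add: None w_def player_def payoff_def distrib_left sum.distrib sum_distrib_left mult_ac)
      then show ?thesis
        using nash[OF ij(2)] pair ij a t0S by (simp add: payoff_upd_diff)
    qed
  qed
  ultimately show ?thesis
    by (elim null_sets_completion_subset[rotated]) blast
qed

section \<open>Covering the games in question by countably many null sets\<close>

lemma payoff_pure:
  assumes "t \<in> action_profiles n A" "finite (action_profiles n A)"
    and f: "\<And>k. k \<in> agents n \<Longrightarrow> f k = dirac (t k)"
  shows "payoff n A U f j = U (j, t)"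
proof -
  have "weight n f a = of_bool (a = t)" if "a \<in> action_profiles n A" for a
  proof (cases "a = t")
    case False
    then obtain k where "k \<in> agents n" "a k \<noteq> t k"
      using PiE_ext[of a "agents n" A t] \<open>a \<in> action_profiles n A\<close> assms(1) False by blast
    then show ?thesis using f False by (auto simp: weight_split)
  qed (use f in \<open>simp add: weight_def\<close>)
  then have "payoff n A U f j = (\<Sum>a\<in>action_profiles n A. if a = t then U (j, a) else 0)"
    unfolding payoff_def by (intro sum.cong) auto
  then show ?thesis using assms by simp
qed

lemma mixed_not_pure:
  assumes "mixed_profile n A x" "\<not> pure_profile n A x"
  obtains i a b where "i \<in> agents n" "a \<in> set_pmf (x i)" "b \<in> set_pmf (x i)" "a \<noteq> b"
proof -
  obtain i where i: "i \<in> agents n" "\<And>a. a \<in> A i \<Longrightarrow> x i \<noteq> return_pmf a"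
    using assms(2) by (auto simp: pure_profile_def)
  obtain a where a: "a \<in> set_pmf (x i)" using set_pmf_not_empty by fast
  then have "x i \<noteq> return_pmf a" using assms(1) i by (metis mixed_profile_def subsetD)
  then obtain b where "b \<in> set_pmf (x i)" "b \<noteq> a" by (auto simp: set_pmf_subset_singleton[symmetric])
  then show thesis using that i(1) a by blast
qed

text \<open>Finitely many positive weights have a common positive lower bound, here of the form
  \<open>1 / Suc r\<close>, so countably many bounds suffice.\<close>

lemma pmf_in_mixtures:
  assumes "\<And>k. k \<in> agents n \<Longrightarrow> finite (set_pmf (x k))"
  shows "\<exists>r. (\<lambda>k. pmf (x k)) \<in> mixtures n (\<lambda>k. set_pmf (x k)) (inverse (real (Suc r)))"
proof -
  let ?F = "SIGMA k:agents n. set_pmf (x k)"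
  have "\<forall>p\<in>?F. eventually (\<lambda>r. inverse (real (Suc r)) < pmf (x (fst p)) (snd p)) sequentially"
    by (auto intro!: order_tendstoD(2)[OF LIMSEQ_inverse_real_of_nat] simp: pmf_positive simp del: of_nat_Suc)
  then have "eventually (\<lambda>r. \<forall>p\<in>?F. inverse (real (Suc r)) < pmf (x (fst p)) (snd p)) sequentially"
    using assms by (intro eventually_ball_finite) auto
  then obtain r where "\<forall>p\<in>?F. inverse (real (Suc r)) < pmf (x (fst p)) (snd p)"
    using eventually_happens trivial_limit_sequentially by blast
  then show ?thesis
    using assms by (intro exI[of _ r]) (force simp: mixtures_def set_pmf_iff sum_pmf_eq_1)
qed

theorem mainTheorem8:
  fixes n :: nat and A :: "nat \<Rightarrow> 'a set"
  assumes "n \<ge> 2" and "\<And>i. i \<in> agents n \<Longrightarrow> finite (A i)"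
  shows "{U \<in> space (lebesgue_games n A).
            \<exists>x. strong_Nash_equilibrium n A U x \<and> \<not> pure_profile n A x}
         \<in> null_sets (lebesgue_games n A)"
proof -
  define I where "I = agents n \<times> action_profiles n A"
  define M where "M = Pi\<^sub>M I (\<lambda>_. lborel :: real measure)"
  define supps where "supps = (\<Pi>\<^sub>E k\<in>agents n. Pow (A k))"
  define Ind where "Ind = {(S, i, j). S \<in> supps \<and> i \<in> agents n \<and> j \<in> agents n \<and> i \<noteq> j \<and>
    (\<exists>t \<in> (\<Pi>\<^sub>E k\<in>agents n. S k). S i - {t i} \<noteq> {} \<and> S j - {t j} \<noteq> {})}"
  define Tie where "Tie = (\<lambda>(u, v). {U \<in> space M. U u = U v})"
  define Pair where "Pair = (\<lambda>((S, i, j), r :: nat). {U \<in> space M. \<exists>f\<in>mixtures n S (inverse (real (Suc r))).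
      (\<forall>k\<in>agents n. \<forall>s\<in>S k. payoff n A U (f(k := dirac s)) k = payoff n A U f k) \<and>
      (\<forall>s\<in>S i. payoff n A U (f(i := dirac s)) j = payoff n A U f j)})"
  have finAP: "finite (action_profiles n A)" using assms(2) by (intro finite_PiE) auto
  have finI: "finite I" using finAP by (simp add: I_def)
  have finInd: "finite Ind"
  proof (rule finite_subset)
    show "Ind \<subseteq> supps \<times> agents n \<times> agents n" unfolding Ind_def by blast
    have "finite supps" using assms(2) unfolding supps_def by (intro finite_PiE) auto
    then show "finite (supps \<times> agents n \<times> agents n)" by (intro finite_cartesian_product finite_atLeastAtMost)
  qed
  have Tie_null: "Tie p \<in> null_sets (completion M)" if "p \<in> (SIGMA u:I. I - {u})" for p
    using hyperplane_null[OF finI, of "fst p" "snd p"] that unfolding Tie_def M_def by (cases p) auto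
  have Pair_null: "Pair p \<in> null_sets (completion M)" if "p \<in> Ind \<times> UNIV" for p
  proof -
    obtain S i j r where p: "p = ((S, i, j), r)" by (metis prod.exhaust)
    have "(S, i, j) \<in> Ind" using that p by simp
    then obtain t a c where *: "S \<in> supps" "t \<in> (\<Pi>\<^sub>E k\<in>agents n. S k)" "i \<in> agents n" "j \<in> agents n" "i \<noteq> j"
        "a \<in> S i" "a \<noteq> t i" "c \<in> S j" "c \<noteq> t j"
      unfolding Ind_def by blast
    have "S k \<subseteq> A k" if "k \<in> agents n" for k
      using *(1) that by (auto simp: supps_def PiE_iff)
    then show ?thesis
      unfolding p Pair_def prod.case M_def I_def
      using assms(2) * by (intro mixing_pair_null[where a = a and c = c and ?t0.0 = t]) (auto simp: inverse_le_1_iff)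
  qed
  have "{U \<in> space M. \<exists>x. strong_Nash_equilibrium n A U x \<and> \<not> pure_profile n A x}
    \<subseteq> (\<Union>p\<in>(SIGMA u:I. I - {u}). Tie p) \<union> (\<Union>p\<in>Ind \<times> UNIV. Pair p)"
  proof safe
    fix U x assume U: "U \<in> space M" and sne: "strong_Nash_equilibrium n A U x"
      and np: "\<not> pure_profile n A x" and not_Pair: "U \<notin> (\<Union>p\<in>Ind \<times> UNIV. Pair p)"
    let ?f = "\<lambda>k. pmf (x k)"
    have x: "mixed_profile n A x" using sne by (simp add: strong_Nash_equilibrium_def)
    have sub: "set_pmf (x k) \<subseteq> A k" if "k \<in> agents n" for k
      using x that by (simp add: mixed_profile_def)
    have fin: "finite (set_pmf (x k))" if "k \<in> agents n" for k
      using finite_subset[OF sub assms(2)] that by blast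
    \<comment> \<open>Restricting to \<open>agents n\<close> makes \<open>S\<close> one of the
      finitely many members of \<open>supps\<close>.\<close>
    define S where "S = (\<lambda>k\<in>agents n. set_pmf (x k))"
    define t where "t = (\<lambda>k\<in>agents n. SOME s. s \<in> set_pmf (x k))"
    have tS: "t k \<in> set_pmf (x k)" if "k \<in> agents n" for k
      using that someI_ex[of "\<lambda>s. s \<in> set_pmf (x k)"] set_pmf_not_empty[of "x k"] by (auto simp: t_def)
    have tAP: "t \<in> action_profiles n A" using tS sub by (intro PiE_I) (blast, simp add: t_def del: atLeastAtMost_iff)
    have "\<exists>r. ?f \<in> mixtures n (\<lambda>k. set_pmf (x k)) (inverse (real (Suc r)))"
      by (rule pmf_in_mixtures) (rule fin)
    then obtain r where r: "?f \<in> mixtures n S (inverse (real (Suc r)))"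
      unfolding mixtures_def S_def by auto
    have nash: "payoff n A U (?f(k := dirac s)) k = payoff n A U ?f k"
      if "k \<in> agents n" "s \<in> set_pmf (x k)" for k s
      by (rule SNE_indifferent[OF _ sne that]) (rule assms(2))
    have no_pair: False
      if ij: "i \<in> agents n" "j \<in> agents n" "i \<noteq> j" and a: "a \<in> set_pmf (x i)" "a \<noteq> t i"
        and c: "c \<in> set_pmf (x j)" "c \<noteq> t j"
        and eq: "\<forall>s\<in>set_pmf (x i). payoff n A U (?f(i := dirac s)) j = payoff n A U ?f j"
      for i j a c
    proof -
      have "((S, i, j), r) \<in> Ind \<times> UNIV"
      proof -
        have "S \<in> supps" using sub by (auto simp: S_def supps_def)
        moreover have "t \<in> (\<Pi>\<^sub>E k\<in>agents n. S k)" using tS by (auto simp: S_def t_def)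
        moreover have "a \<in> S i - {t i}" "c \<in> S j - {t j}" using ij a c by (auto simp: S_def)
        ultimately show ?thesis using ij unfolding Ind_def by blast
      qed
      moreover have "U \<in> Pair ((S, i, j), r)"
        unfolding Pair_def prod.case using U r nash eq ij by (auto simp: S_def intro!: bexI[of _ ?f])
      ultimately show False using not_Pair by blast
    qed
    \<comment> \<open>Of two distinct supported actions of \<open>i\<close>, at least one differs
      from the reference action \<open>t i\<close>.\<close>
    obtain i a where i: "i \<in> agents n" and a: "a \<in> set_pmf (x i)" "a \<noteq> t i"
      using mixed_not_pure[OF x np] by metis
    \<comment> \<open>If \<open>j\<close> mixed as well, \<open>SNE_pair_indifferent\<close> would
      put \<open>U\<close> into a \<open>Pair\<close> set for \<open>(i, j)\<close> or for
      \<open>(j, i)\<close>.\<close>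
    have single: "c = t j" if j: "j \<in> agents n" "j \<noteq> i" and c: "c \<in> set_pmf (x j)" for j c
    proof (rule ccontr)
      assume "c \<noteq> t j"
      moreover have "(\<forall>s\<in>set_pmf (x i). payoff n A U (?f(i := dirac s)) j = payoff n A U ?f j) \<or>
          (\<forall>s\<in>set_pmf (x j). payoff n A U (?f(j := dirac s)) i = payoff n A U ?f i)"
        using j by (intro SNE_pair_indifferent[OF _ sne i]) (auto intro: assms(2))
      ultimately show False
        using no_pair[OF i j(1) _ a c] no_pair[OF j(1) i j(2) c _ a] j(2) by fastforce
    qed
    have pure: "?f j = dirac (t j)" if j: "j \<in> agents n" "j \<noteq> i" for j
    proof -
      have "x j = return_pmf (t j)" using single[OF j] by (auto simp: set_pmf_subset_singleton[symmetric])
      then show ?thesis by (auto simp: pmf_return)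
    qed
    \<comment> \<open>With all others pure, the payoff of \<open>i\<close> from a pure action is a
      single coordinate of \<open>U\<close>; the indifference of \<open>i\<close> between
      \<open>a\<close> and \<open>t i\<close> thus becomes a tie.\<close>
    have val: "payoff n A U (?f(i := dirac s)) i = U (i, t(i := s))" if "s \<in> set_pmf (x i)" for s
      using tAP sub i that pure
      by (intro payoff_pure[OF _ finAP]) (auto simp: PiE_iff extensional_def)
    have "U (i, t(i := a)) = U (i, t)"
      using val[OF a(1)] val[OF tS[OF i]] nash[OF i a(1)] nash[OF i tS[OF i]] by simp
    then have "U \<in> Tie ((i, t(i := a)), (i, t))" using U by (simp add: Tie_def)
    moreover have "t(i := a) \<in> action_profiles n A"
      using tAP sub i a by (auto simp: PiE_iff extensional_def)
    moreover have "t(i := a) \<noteq> t" using a(2) by (metis fun_upd_same)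
    ultimately show "U \<in> (\<Union>p\<in>(SIGMA u:I. I - {u}). Tie p)"
      using i tAP by (intro UN_I[of "((i, t(i := a)), (i, t))"]) (auto simp: I_def)
  qed
  moreover have "(\<Union>p\<in>(SIGMA u:I. I - {u}). Tie p) \<union> (\<Union>p\<in>Ind \<times> UNIV. Pair p) \<in> null_sets (completion M)"
  proof (intro null_sets.Un null_sets_UN')
    show "countable (SIGMA u:I. I - {u})" "countable (Ind \<times> (UNIV :: nat set))"
      using finI finInd by (auto intro: countable_finite)
  qed (fact Tie_null Pair_null)+
  ultimately show ?thesis
    unfolding lebesgue_games_def space_completion
    unfolding I_def[symmetric] M_def[symmetric] by (rule null_sets_completion_subset)
qed

end
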